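(* Let $\Gamma$ be a metrized graph with $\ell(\Gamma)=1$, let $n\ge 2$ be an integer, and let $\Gamma^{DA,n}$ be obtained from $\Gamma$ by replacing each edge $e_i$ (of length $L_i$) by $n$ edges with the same end points, each of length $L_i/n$. If $\tau(\Gamma^{DA,n})\ge\frac1{108}\big(\frac{3n-2}{n}\big)^2$, then $\tau(\Gamma)\ge\frac1{108}$.
   Context: A metrized graph is a finite connected graph (multiple edges and self-loops allowed) in which each edge is identified with a closed interval of positive length; $\ell(\Gamma)$ is the total length. Regard it as a resistive circuit with segment resistance equal to length, with effective resistance $r(x,y)$. The tau constant is $\tau(\Gamma)=\frac14\int_\Gamma\big(\frac{\partial}{\partial x}r(x,y)\big)^2dx$ (independent of $y$). *)

theory Defs
  imports "HOL-Analysis.Analysis" "Graph_Theory.Digraph_Component"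
begin

text \<open>
  A metrized graph is given by a finite connected multigraph \<open>G\<close> and a length function \<open>len\<close> on
  its edges. Parallel arcs and loops are allowed. The direction of an arc \<open>e\<close> only records how the
  edge is identified with the interval \<open>[0, len e]\<close>.
\<close>

definition metrized_graph :: "('v, 'e) pre_digraph \<Rightarrow> ('e \<Rightarrow> real) \<Rightarrow> bool" where
  "metrized_graph G len \<longleftrightarrow>
     fin_digraph G \<and> Digraph_Component.connected G \<and> (\<forall>e\<in>arcs G. len e > 0)"

definition total_length :: "('v, 'e) pre_digraph \<Rightarrow> ('e \<Rightarrow> real) \<Rightarrow> real" where
  "total_length G len = (\<Sum>e\<in>arcs G. len e)"

datatype ('v, 'e) gpoint = Vertex 'v | Inner 'e real

definition gpoints :: "('v, 'e) pre_digraph \<Rightarrow> ('e \<Rightarrow> real) \<Rightarrow> ('v, 'e) gpoint set" where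
  "gpoints G len = Vertex ` verts G \<union> {Inner e t |e t. e \<in> arcs G \<and> 0 < t \<and> t < len e}"

definition edge_point :: "('v, 'e) pre_digraph \<Rightarrow> ('e \<Rightarrow> real) \<Rightarrow> 'e \<Rightarrow> real \<Rightarrow> ('v, 'e) gpoint" where
  "edge_point G len e t =
     (if t \<le> 0 then Vertex (tail G e) else if t \<ge> len e then Vertex (head G e) else Inner e t)"

text \<open>
  Effective resistance in a finite circuit \<open>H\<close> with resistances \<open>R\<close>: the potential difference
  between \<open>p\<close> and \<open>q\<close> when a unit current enters at \<open>p\<close> and leaves at \<open>q\<close>. The currents are given by
  Ohm's law, and the requirement on the potential is Kirchhoff's current law.
\<close>

definition net_current :: "('a, 'b) pre_digraph \<Rightarrow> ('b \<Rightarrow> real) \<Rightarrow> ('a \<Rightarrow> real) \<Rightarrow> 'a \<Rightarrow> real" where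
  "net_current H R f u =
     (\<Sum>a\<in>out_arcs H u. (f u - f (head H a)) / R a) + (\<Sum>a\<in>in_arcs H u. (f u - f (tail H a)) / R a)"

definition unit_current_potential ::
  "('a, 'b) pre_digraph \<Rightarrow> ('b \<Rightarrow> real) \<Rightarrow> 'a \<Rightarrow> 'a \<Rightarrow> ('a \<Rightarrow> real) \<Rightarrow> bool" where
  "unit_current_potential H R p q f \<longleftrightarrow>
     (\<forall>u\<in>verts H. net_current H R f u = of_bool (u = p) - of_bool (u = q))"

definition effective_resistance :: "('a, 'b) pre_digraph \<Rightarrow> ('b \<Rightarrow> real) \<Rightarrow> 'a \<Rightarrow> 'a \<Rightarrow> real" where
  "effective_resistance H R p q = (THE r. \<exists>f. unit_current_potential H R p q f \<and> r = f p - f q)"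

text \<open>
  The circuit obtained by making every point of \<open>W\<close> a vertex: each edge \<open>e\<close> is cut at the points of
  \<open>W\<close> in its interior, and \<open>(e, a, b)\<close> is the segment of \<open>e\<close> between the consecutive cuts \<open>a < b\<close>,
  with resistance \<open>b - a\<close>.
\<close>

definition cuts :: "('e \<Rightarrow> real) \<Rightarrow> ('v, 'e) gpoint set \<Rightarrow> 'e \<Rightarrow> real set" where
  "cuts len W e = {0, len e} \<union> {t. Inner e t \<in> W}"

definition subdivided ::
  "('v, 'e) pre_digraph \<Rightarrow> ('e \<Rightarrow> real) \<Rightarrow> ('v, 'e) gpoint set
     \<Rightarrow> (('v, 'e) gpoint, 'e \<times> real \<times> real) pre_digraph" where
  "subdivided G len W =
     \<lparr> verts = Vertex ` verts G \<union> W,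
       arcs = {(e, a, b). e \<in> arcs G \<and> a \<in> cuts len W e \<and> b \<in> cuts len W e \<and> a < b \<and>
                 cuts len W e \<inter> {a<..<b} = {}},
       tail = (\<lambda>(e, a, b). edge_point G len e a),
       head = (\<lambda>(e, a, b). edge_point G len e b) \<rparr>"

definition segment_resistance :: "'e \<times> real \<times> real \<Rightarrow> real" where
  "segment_resistance = (\<lambda>(e, a, b). b - a)"

definition resistance ::
  "('v, 'e) pre_digraph \<Rightarrow> ('e \<Rightarrow> real) \<Rightarrow> ('v, 'e) gpoint \<Rightarrow> ('v, 'e) gpoint \<Rightarrow> real" where
  "resistance G len x y =
     effective_resistance (subdivided G len {x, y}) segment_resistance x y"

definition tau_at :: "('v, 'e) pre_digraph \<Rightarrow> ('e \<Rightarrow> real) \<Rightarrow> ('v, 'e) gpoint \<Rightarrow> real" where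
  "tau_at G len y =
     1 / 4 * (\<Sum>e\<in>arcs G. integral {0..len e}
       (\<lambda>t. (deriv (\<lambda>s. resistance G len (edge_point G len e s) y) t)\<^sup>2))"

text \<open>The value of \<open>tau_at\<close> does not depend on the base point; \<open>tau\<close> is the common value.\<close>

definition tau :: "('v, 'e) pre_digraph \<Rightarrow> ('e \<Rightarrow> real) \<Rightarrow> real" where
  "tau G len = (THE c. \<forall>y\<in>gpoints G len. tau_at G len y = c)"

definition DA_graph :: "nat \<Rightarrow> ('v, 'e) pre_digraph \<Rightarrow> ('v, 'e \<times> nat) pre_digraph" where
  "DA_graph n G =
     \<lparr> verts = verts G, arcs = arcs G \<times> {..<n},
       tail = (\<lambda>(e, i). tail G e), head = (\<lambda>(e, i). head G e) \<rparr>"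

definition DA_length :: "nat \<Rightarrow> ('e \<Rightarrow> real) \<Rightarrow> 'e \<times> nat \<Rightarrow> real" where
  "DA_length n len = (\<lambda>(e, i). len e / real n)"

end

theory Submission
  imports Defs
begin

text \<open>
  Let \<open>k\<close> be the Green's kernel of the vertex Laplacian grounded at a vertex \<open>b\<close>, let \<open>d u = k u u\<close>
  and let \<open>r\<^sub>e\<close> be the effective resistance between the ends of an edge \<open>e\<close> of length \<open>L\<^sub>e\<close>. The
  Green's function of the metrized graph is the linear interpolation of \<open>k\<close> plus the Dirichlet
  Green's functions of the edges; integrating the square of the derivative of the resulting
  piecewise quadratic \<open>r(x, y)\<close>, all dependence on \<open>y\<close> cancels and
  \<open>4 \<tau> = E(d, d) + \<Sum>\<^sub>e (L\<^sub>e - r\<^sub>e)\<^sup>2 / (3 L\<^sub>e)\<close>, with \<open>E\<close> the Dirichlet form. Replacing each edge by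
  \<open>n\<close> edges of length \<open>L\<^sub>e / n\<close> divides \<open>k\<close> by \<open>n\<^sup>2\<close>, so for total length 1 and \<open>S = \<Sum>\<^sub>e r\<^sub>e\<close> the
  constant \<open>\<tau>'\<close> of the new graph satisfies \<open>4 n\<^sup>2 \<tau>' = 4 \<tau> + (n - 1) (n + 1 - 2 S) / 3\<close>. If
  \<open>S \<ge> 2/3\<close>, the bound on \<open>\<tau>'\<close> gives \<open>\<tau> \<ge> 1/108\<close>; if \<open>S \<le> 2/3\<close>, Cauchy--Schwarz gives
  \<open>4 \<tau> \<ge> (1 - S)\<^sup>2 / 3 \<ge> 1/27\<close>.
\<close>

section \<open>Energy form of a circuit and Kirchhoff's current law\<close>

definition dirichlet_form ::
  "('a, 'b) pre_digraph \<Rightarrow> ('b \<Rightarrow> real) \<Rightarrow> ('a \<Rightarrow> real) \<Rightarrow> ('a \<Rightarrow> real) \<Rightarrow> real" where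
  "dirichlet_form H R f g =
     (\<Sum>a\<in>arcs H. (f (head H a) - f (tail H a)) * (g (head H a) - g (tail H a)) / R a)"

lemma dirichlet_form_commute: "dirichlet_form H R f g = dirichlet_form H R g f"
  by (simp add: dirichlet_form_def mult.commute)

lemma dirichlet_form_diff_left:
  "dirichlet_form H R (\<lambda>u. f u - g u) h = dirichlet_form H R f h - dirichlet_form H R g h"
  unfolding dirichlet_form_def sum_subtractf[symmetric]
  by (intro sum.cong refl) (simp add: algebra_simps diff_divide_distrib add_divide_distrib)

lemma dirichlet_form_lincomb_left:
  "dirichlet_form H R (\<lambda>u. c * f u + d * g u) h =
     c * dirichlet_form H R f h + d * dirichlet_form H R g h"
  unfolding dirichlet_form_def sum_distrib_left sum.distrib[symmetric]
  by (intro sum.cong refl) (simp add: algebra_simps diff_divide_distrib add_divide_distrib)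

text \<open>Summation by parts: grouping the arcs once by tail and once by head collects, for each
  arc, the contributions at its two ends. The current law thereby becomes a statement about the form
  against test functions.\<close>

lemma sum_net_current:
  assumes "fin_digraph H"
  shows "(\<Sum>u\<in>verts H. g u * net_current H R f u) = dirichlet_form H R f g"
proof -
  interpret fin_digraph H by fact
  have out: "(\<Sum>u\<in>verts H. g u * (\<Sum>a\<in>out_arcs H u. (f u - f (head H a)) / R a)) =
      (\<Sum>a\<in>arcs H. g (tail H a) * (f (tail H a) - f (head H a)) / R a)" (is "?l = ?r")
  proof -
    have "?l = (\<Sum>u\<in>verts H. \<Sum>a\<in>{a\<in>arcs H. tail H a = u}.
        g (tail H a) * (f (tail H a) - f (head H a)) / R a)"
      by (intro sum.cong refl) (auto simp: sum_distrib_left out_arcs_def intro!: sum.cong)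
    also have "\<dots> = ?r"
      by (rule sum.group) auto
    finally show ?thesis .
  qed
  have inn: "(\<Sum>u\<in>verts H. g u * (\<Sum>a\<in>in_arcs H u. (f u - f (tail H a)) / R a)) =
      (\<Sum>a\<in>arcs H. g (head H a) * (f (head H a) - f (tail H a)) / R a)" (is "?l = ?r")
  proof -
    have "?l = (\<Sum>u\<in>verts H. \<Sum>a\<in>{a\<in>arcs H. head H a = u}.
        g (head H a) * (f (head H a) - f (tail H a)) / R a)"
      by (intro sum.cong refl) (auto simp: sum_distrib_left in_arcs_def intro!: sum.cong)
    also have "\<dots> = ?r"
      by (rule sum.group) auto
    finally show ?thesis .
  qed
  show ?thesis
    unfolding net_current_def distrib_left sum.distrib out inn dirichlet_form_def
    unfolding sum.distrib[symmetric]
    by (intro sum.cong refl) (simp add: algebra_simps diff_divide_distrib add_divide_distrib)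
qed

text \<open>The way back: testing with a point mass recovers the current at \<open>u\<close> from
  the form.\<close>

lemma net_current_eq_dirichlet_form:
  assumes "fin_digraph H" "u \<in> verts H"
  shows "net_current H R f u = dirichlet_form H R f (\<lambda>v. of_bool (v = u))"
proof -
  interpret fin_digraph H by fact
  have "(\<Sum>v\<in>verts H. of_bool (v = u) * net_current H R f v) = net_current H R f u"
    using assms(2) by (simp add: of_bool_def if_distrib[of "\<lambda>x. x * _"] cong: if_cong)
  then show ?thesis
    using sum_net_current[OF assms(1), of "\<lambda>v. of_bool (v = u)" R f] by simp
qed

text \<open>Testing two unit current potentials against each other expresses both voltages as the
  same value of the symmetric form. So the voltage is unique although constants may be added to the
  potential.\<close>

lemma effective_resistance_eqI:
  assumes "fin_digraph H" "p \<in> verts H" "q \<in> verts H" "unit_current_potential H R p q f"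
  shows "effective_resistance H R p q = f p - f q"
proof -
  interpret fin_digraph H by fact
  have *: "dirichlet_form H R f' g = g p - g q" if "unit_current_potential H R p q f'" for f' g
  proof -
    have "dirichlet_form H R f' g = (\<Sum>u\<in>verts H. g u * (of_bool (u = p) - of_bool (u = q)))"
      using that unfolding sum_net_current[OF assms(1), symmetric] unit_current_potential_def
      by simp
    also have "\<dots> = g p - g q"
      using assms(2,3)
      by (simp add: right_diff_distrib sum_subtractf of_bool_def if_distrib[of "\<lambda>x. _ * x"] cong: if_cong)
    finally show ?thesis .
  qed
  show ?thesis
    unfolding effective_resistance_def
  proof (rule the_equality)
    show "\<exists>f'. unit_current_potential H R p q f' \<and> f p - f q = f' p - f' q"
      using assms(4) by blast
    show "r = f p - f q" if "\<exists>f'. unit_current_potential H R p q f' \<and> r = f' p - f' q" for r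
      using that *[of _ f] *[OF assms(4)] *
      by (metis dirichlet_form_commute)
  qed
qed

section \<open>Existence of the grounded Green's kernel\<close>

text \<open>Fredholm alternative for a positive semidefinite form. Induction on the rank-one terms
  with \<open>b\<close> arbitrary: the hypothesis is applied to \<open>d j\<close> and then to
  \<open>b\<close> or a corrected \<open>b'\<close>, and the result is updated explicitly.\<close>

lemma rank_one_sum_fredholm:
  fixes c :: "'i \<Rightarrow> real" and d :: "'i \<Rightarrow> 'v \<Rightarrow> real"
  assumes "finite V" "finite I" "\<And>i. i \<in> I \<Longrightarrow> c i > 0"
  defines "pair \<equiv> \<lambda>f g. \<Sum>v\<in>V. f v * g v"
  shows "\<exists>f. (\<forall>h. (\<Sum>i\<in>I. c i * pair f (d i) * pair h (d i)) = pair h b) \<or>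
    ((\<forall>h. (\<Sum>i\<in>I. c i * pair f (d i) * pair h (d i)) = 0) \<and> pair f b \<noteq> 0)"
  using assms(2,3)
proof (induction I arbitrary: b rule: finite_induct)
  case empty
  show ?case
  proof (cases "\<forall>v\<in>V. b v = 0")
    case True
    then show ?thesis by (intro exI[of _ "\<lambda>_. 0"]) (simp add: pair_def)
  next
    case False
    then have "pair b b \<noteq> 0"
      using \<open>finite V\<close> by (auto simp: pair_def sum_nonneg_eq_0_iff)
    then show ?thesis by auto
  qed
next
  case (insert j I)
  have lin1: "pair (\<lambda>v. f v + x * g v) h = pair f h + x * pair g h" for f g h x
    by (simp add: pair_def algebra_simps sum.distrib sum_distrib_left)
  have lin2: "pair h (\<lambda>v. f v - x * g v) = pair h f - x * pair h g" for f g h x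
    by (simp add: pair_def algebra_simps sum_subtractf sum_distrib_left)
  define E where "E f h = (\<Sum>i\<in>I. c i * pair f (d i) * pair h (d i))" for f h
  have E_lin: "E (\<lambda>v. f v + x * g v) h = E f h + x * E g h" for f g h x
    unfolding E_def lin1 by (simp add: algebra_simps sum.distrib sum_distrib_left)
  have E_sym: "E f h = E h f" for f h
    by (simp add: E_def mult_ac)
  have E_pos: "E f f \<ge> 0" for f
    unfolding E_def using insert.prems
    by (intro sum_nonneg) (simp add: mult.assoc order_less_imp_le)
  have E_insert: "(\<Sum>i\<in>insert j I. c i * pair f (d i) * pair h (d i)) =
      E f h + c j * pair f (d j) * pair h (d j)" for f h
    using insert.hyps by (simp add: E_def)
  have c: "c j > 0" using insert.prems by simp
  have IH: "\<exists>f. (\<forall>h. E f h = pair h b) \<or> ((\<forall>h. E f h = 0) \<and> pair f b \<noteq> 0)" for b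
    using insert.IH[of b] insert.prems by (simp add: E_def)
  consider f0 where "\<And>h. E f0 h = pair h (d j)"
    | f0 where "\<And>h. E f0 h = 0" "pair f0 (d j) \<noteq> 0"
    using IH[of "d j"] by blast
  then show ?case
  proof cases
    case 1
    \<comment> \<open>Nonzero denominator of the Sherman-Morrison coefficient \<open>x\<close>
      below, which makes the contributions of \<open>pair h (d j)\<close> cancel.\<close>
    have t: "1 + c j * pair f0 (d j) > 0"
      using E_pos[of f0] 1[of f0] c by (simp add: add_pos_nonneg)
    consider g where "\<And>h. E g h = pair h b" | g where "\<And>h. E g h = 0" "pair g b \<noteq> 0"
      using IH[of b] by blast
    then show ?thesis
    proof cases
      case g: 1
      define x where "x = - c j * pair g (d j) / (1 + c j * pair f0 (d j))"
      have "x * (1 + c j * pair f0 (d j)) = - c j * pair g (d j)"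
        using t by (simp add: x_def)
      then have x: "x + c j * (pair g (d j) + x * pair f0 (d j)) = 0"
        by (simp add: algebra_simps)
      have "E (\<lambda>v. g v + x * f0 v) h + c j * pair (\<lambda>v. g v + x * f0 v) (d j) * pair h (d j)
          = pair h b" for h
      proof -
        have "E (\<lambda>v. g v + x * f0 v) h + c j * pair (\<lambda>v. g v + x * f0 v) (d j) * pair h (d j)
          = pair h b + (x + c j * (pair g (d j) + x * pair f0 (d j))) * pair h (d j)"
          unfolding E_lin lin1 g 1 by (simp add: algebra_simps)
        then show ?thesis using x by simp
      qed
      then show ?thesis unfolding E_insert by blast
    next
      case g: 2
      \<comment> \<open>Since \<open>f0\<close> represents \<open>d j\<close>, a null vector of the
        old form is orthogonal to \<open>d j\<close> and remains null.\<close>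
      have "pair g (d j) = 0"
        using 1[of g] E_sym[of f0 g] g(1) by simp
      then show ?thesis unfolding E_insert using g by (intro exI[of _ g]) simp
    qed
  next
    case 2
    \<comment> \<open>The multiple of \<open>d j\<close> whose removal makes the right-hand side
      orthogonal to the null vector \<open>f0\<close>.\<close>
    define x where "x = pair f0 b / pair f0 (d j)"
    define b' where "b' v = b v - x * d j v" for v
    have b': "pair h b' = pair h b - x * pair h (d j)" for h
      unfolding b'_def by (rule lin2)
    consider g where "\<And>h. E g h = pair h b'" | g where "\<And>h. E g h = 0" "pair g b' \<noteq> 0"
      using IH[of b'] by blast
    then show ?thesis
    proof cases
      case g: 1
      \<comment> \<open>Adding a multiple of \<open>f0\<close> does not change the old form; this
        one makes the new term supply the missing \<open>x * pair h (d j)\<close>.\<close>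
      define y where "y = (x / c j - pair g (d j)) / pair f0 (d j)"
      have "c j * (pair g (d j) + y * pair f0 (d j)) = x"
        using c 2(2) by (simp add: y_def)
      then have "E (\<lambda>v. g v + y * f0 v) h + c j * pair (\<lambda>v. g v + y * f0 v) (d j) * pair h (d j)
          = pair h b" for h
        unfolding E_lin lin1 g 2 b' by simp
      then show ?thesis unfolding E_insert by blast
    next
      case g: 2
      \<comment> \<open>Cancels the pairing with \<open>d j\<close>, so that the combination is null
        for the enlarged form as well.\<close>
      define y where "y = - (pair g (d j) / pair f0 (d j))"
      have "pair (\<lambda>v. g v + y * f0 v) (d j) = 0"
        unfolding lin1 using 2(2) by (simp add: y_def)
      moreover have "pair (\<lambda>v. g v + y * f0 v) b = pair g b'"
        unfolding lin1 b' by (simp add: y_def x_def)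
      moreover have "E (\<lambda>v. g v + y * f0 v) h = 0" for h
        unfolding E_lin g 2 by simp
      ultimately show ?thesis unfolding E_insert using g(2)
        by (intro exI[of _ "\<lambda>v. g v + y * f0 v"]) simp
    qed
  qed
qed

text \<open>\<open>k w\<close> is the potential of a unit current from \<open>w\<close> to
  \<open>b\<close>, normalized at \<open>b\<close>. It is stated weakly, as a reproducing property
  for the Dirichlet form.\<close>

definition grounded_green ::
  "('v, 'e) pre_digraph \<Rightarrow> ('e \<Rightarrow> real) \<Rightarrow> 'v \<Rightarrow> ('v \<Rightarrow> 'v \<Rightarrow> real) \<Rightarrow> bool" where
  "grounded_green G len b k \<longleftrightarrow> b \<in> verts G \<and>
     (\<forall>w\<in>verts G. k w b = 0 \<and> (\<forall>f. dirichlet_form G len (k w) f = f w - f b))"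

text \<open>Used for functions of zero energy: equality spreads along arcs, which
  \<open>mk_symmetric\<close> lets one traverse in either direction.\<close>

lemma metrized_graph_connected_const:
  assumes "metrized_graph G len" "\<And>a. a \<in> arcs G \<Longrightarrow> f (head G a) = f (tail G a)"
    "u \<in> verts G" "v \<in> verts G"
  shows "f u = f v"
proof -
  have sc: "strongly_connected (with_proj (mk_symmetric G))"
    using assms(1) by (simp add: metrized_graph_def connected_def)
  then have "u \<rightarrow>\<^sup>*\<^bsub>with_proj (mk_symmetric G)\<^esub> v"
    using assms(3,4) by (auto simp: strongly_connected_def mk_symmetric_def)
  then have "(u, v) \<in> (arcs_ends (with_proj (mk_symmetric G)))\<^sup>*"
    by (rule reachable_rtranclI)
  then show ?thesis
  proof (induction rule: rtrancl_induct)
    case base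
    then show ?case by simp
  next
    case (step x y)
    then have "f x = f y" using assms(2)
      by (auto simp: mk_symmetric_def arcs_ends_def arc_to_ends_def)
    then show ?case using step by simp
  qed
qed

text \<open>The right-hand side is the difference of the point masses at \<open>w\<close> and
  \<open>b\<close>. The second alternative fails: a null function has zero energy, hence is constant
  by connectedness and pairs to zero.\<close>

lemma grounded_green_exists:
  assumes mg: "metrized_graph G len"
  shows "\<exists>b k. grounded_green G len b k"
proof -
  interpret fin_digraph G using mg by (simp add: metrized_graph_def)
  have pos: "len a > 0" if "a \<in> arcs G" for a
    using mg that by (simp add: metrized_graph_def)
  have "verts G \<noteq> {}"
    using mg by (auto simp: metrized_graph_def connected_def strongly_connected_def)
  then obtain b where b: "b \<in> verts G" by blast
  define pair where "pair f g = (\<Sum>v\<in>verts G. f v * g v :: real)" for f g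
  define d where "d a v = (of_bool (v = head G a) - of_bool (v = tail G a) :: real)" for a v
  have pair_delta: "pair f (\<lambda>v. of_bool (v = x) - of_bool (v = y)) = f x - f y"
    if "x \<in> verts G" "y \<in> verts G" for f x y
    using that
    by (simp add: pair_def right_diff_distrib sum_subtractf of_bool_def if_distrib[of "\<lambda>x. _ * x"] cong: if_cong)
  have E: "(\<Sum>a\<in>arcs G. 1 / len a * pair f (d a) * pair h (d a)) = dirichlet_form G len f h" for f h
    unfolding dirichlet_form_def d_def by (intro sum.cong refl) (simp add: pair_delta)
  have "\<exists>f. f b = 0 \<and> (\<forall>h. dirichlet_form G len f h = h w - h b)" if w: "w \<in> verts G" for w
  proof -
    define \<beta> where "\<beta> v = (of_bool (v = w) - of_bool (v = b) :: real)" for v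
    have \<beta>: "pair f \<beta> = f w - f b" for f
      unfolding \<beta>_def using w b by (rule pair_delta)
    obtain f where "(\<forall>h. dirichlet_form G len f h = pair h \<beta>) \<or>
        ((\<forall>h. dirichlet_form G len f h = 0) \<and> pair f \<beta> \<noteq> 0)"
      using rank_one_sum_fredholm[of "verts G" "arcs G" "\<lambda>a. 1 / len a" d \<beta>,
          folded pair_def, unfolded E] pos
      by auto
    moreover have "pair f \<beta> = 0" if "\<forall>h. dirichlet_form G len f h = 0"
    proof -
      have "dirichlet_form G len f f = 0" using that by simp
      then have "\<forall>a\<in>arcs G. (f (head G a) - f (tail G a)) * (f (head G a) - f (tail G a)) / len a = 0"
        unfolding dirichlet_form_def using pos
        by (subst (asm) sum_nonneg_eq_0_iff) (auto simp: order_less_imp_le)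
      then have "f (head G a) = f (tail G a)" if "a \<in> arcs G" for a
        using that pos[OF that] by auto
      then have "f w = f b" using metrized_graph_connected_const[OF mg _ w b] by blast
      then show ?thesis by (simp add: \<beta>)
    qed
    ultimately have f: "dirichlet_form G len f h = h w - h b" for h by (auto simp: \<beta>)
    then have "dirichlet_form G len (\<lambda>v. f v - f b) h = h w - h b" for h
      by (simp add: dirichlet_form_def)
    then show ?thesis by (intro exI[of _ "\<lambda>v. f v - f b"]) simp
  qed
  then obtain k where "\<forall>w\<in>verts G. k w b = 0 \<and> (\<forall>h. dirichlet_form G len (k w) h = h w - h b)"
    by metis
  then show ?thesis using b unfolding grounded_green_def by blast
qed

text \<open>Both values equal the symmetric form at \<open>k u\<close> and \<open>k w\<close>,
  because the kernel vanishes at \<open>b\<close>.\<close>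

lemma grounded_green_commute:
  assumes "grounded_green G len b k" "u \<in> verts G" "w \<in> verts G"
  shows "k u w = k w u"
  using assms unfolding grounded_green_def
  by (metis diff_zero dirichlet_form_commute)

section \<open>Sums over the segments of a subdivided edge\<close>

definition consecutive :: "real set \<Rightarrow> (real \<times> real) set" where
  "consecutive C = {(a, b). a \<in> C \<and> b \<in> C \<and> a < b \<and> C \<inter> {a<..<b} = {}}"

lemma finite_consecutive: "finite C \<Longrightarrow> finite (consecutive C)"
  by (rule finite_subset[of _ "C \<times> C"]) (auto simp: consecutive_def)

text \<open>Induction adds a new largest point, which creates exactly one new pair, starting at the
  old maximum.\<close>

lemma sum_consecutive_telescope:
  fixes f :: "real \<Rightarrow> real"
  assumes "finite C" "C \<noteq> {}"
  shows "(\<Sum>(a, b)\<in>consecutive C. f b - f a) = f (Max C) - f (Min C)"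
  using assms
proof (induction C rule: finite_linorder_max_induct)
  case empty
  then show ?case by simp
next
  case (insert m C)
  show ?case
  proof (cases "C = {}")
    case True
    then have "consecutive (insert m C) = {}" by (auto simp: consecutive_def)
    then show ?thesis using True by simp
  next
    case False
    have mx: "Max C \<in> C" "\<And>a. a \<in> C \<Longrightarrow> a \<le> Max C"
      using insert.hyps False by auto
    have eq: "consecutive (insert m C) = insert (Max C, m) (consecutive C)"
    proof (intro equalityI subsetI)
      fix p assume "p \<in> consecutive (insert m C)"
      then obtain a b where p: "p = (a, b)" "a \<in> insert m C" "b \<in> insert m C" "a < b"
        "insert m C \<inter> {a<..<b} = {}"
        by (auto simp: consecutive_def)
      show "p \<in> insert (Max C, m) (consecutive C)"
      proof (cases "b = m")
        case True
        then have "a \<in> C" using p by auto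
        moreover have "\<not> a < Max C" using p(5) mx(1) True insert.hyps by auto
        ultimately show ?thesis using mx(2)[of a] p True by auto
      next
        case False
        then have "b \<in> C" "a \<in> C" using p insert.hyps by force+
        then show ?thesis using p by (auto simp: consecutive_def)
      qed
    next
      fix p assume "p \<in> insert (Max C, m) (consecutive C)"
      then consider "p = (Max C, m)" | "p \<in> consecutive C" by blast
      then show "p \<in> consecutive (insert m C)"
      proof cases
        case 1
        then show ?thesis
          using mx insert.hyps(2) by (auto simp: consecutive_def not_less[symmetric])
      next
        case 2
        then show ?thesis
          using insert.hyps(2) by (auto simp: consecutive_def not_less_iff_gr_or_eq)
      qed
    qed
    have "(Max C, m) \<notin> consecutive C" using insert.hyps by (auto simp: consecutive_def)
    moreover have "Max (insert m C) = m"
      using insert.hyps by (intro Max_eqI) (auto simp: order_less_imp_le)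
    moreover have "Min (insert m C) = Min C"
      using bspec[OF insert.hyps(2) Min_in[OF insert.hyps(1) False]]
      by (simp add: Min_insert[OF insert.hyps(1) False] min_absorb2)
    ultimately show ?thesis
      using insert.hyps insert.IH[OF False] finite_consecutive[of C] by (simp add: eq)
  qed
qed

text \<open>A function of slope \<open>q\<close> carries the same current through every segment, so
  its energy pairing with any \<open>f\<close> telescopes.\<close>

lemma sum_consecutive_affine:
  fixes f :: "real \<Rightarrow> real"
  assumes "finite C" "C \<noteq> {}"
  shows "(\<Sum>(a, b)\<in>consecutive C. (q * b - q * a) * (f b - f a) / (b - a)) =
    q * (f (Max C) - f (Min C))"
proof -
  have "(\<Sum>(a, b)\<in>consecutive C. (q * b - q * a) * (f b - f a) / (b - a)) =
    (\<Sum>(a, b)\<in>consecutive C. q * f b - q * f a)"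
    by (intro sum.cong refl) (auto simp: consecutive_def field_simps)
  also have "\<dots> = q * (f (Max C) - f (Min C))"
    using sum_consecutive_telescope[OF assms, of "\<lambda>t. q * f t"] by (simp add: algebra_simps)
  finally show ?thesis .
qed

text \<open>Green's function of the interval \<open>[0, L]\<close> with Dirichlet boundary conditions.\<close>

definition edge_green :: "real \<Rightarrow> real \<Rightarrow> real \<Rightarrow> real" where
  "edge_green L s t = min s t * (L - max s t) / L"

text \<open>The Green's function is affine with slope \<open>1 - t / L\<close> before
  \<open>t\<close> and \<open>- (t / L)\<close> after it, and each side telescopes. As
  \<open>t\<close> is itself a cut, no segment straddles it.\<close>

lemma sum_consecutive_edge_green:
  fixes f :: "real \<Rightarrow> real"
  assumes "finite C" "C \<subseteq> {0..L}" "0 \<in> C" "L \<in> C" "t \<in> C" "0 < t" "t < L"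
  shows "(\<Sum>(a, b)\<in>consecutive C. (edge_green L b t - edge_green L a t) * (f b - f a) / (b - a)) =
    f t - ((1 - t / L) * f 0 + t / L * f L)"
proof -
  let ?A = "C \<inter> {..t}" and ?B = "C \<inter> {t..}"
  let ?g = "\<lambda>(a, b). (edge_green L b t - edge_green L a t) * (f b - f a) / (b - a)"
  have split: "consecutive C = consecutive ?A \<union> consecutive ?B"
  proof (intro equalityI subsetI)
    fix p assume "p \<in> consecutive C"
    then obtain a b where p: "p = (a, b)" "a \<in> C" "b \<in> C" "a < b" "C \<inter> {a<..<b} = {}"
      by (auto simp: consecutive_def)
    then have "t \<le> a \<or> b \<le> t" using assms(5) by force
    then show "p \<in> consecutive ?A \<union> consecutive ?B" using p by (auto simp: consecutive_def)
  next
    fix p assume "p \<in> consecutive ?A \<union> consecutive ?B"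
    then show "p \<in> consecutive C" by (fastforce simp: consecutive_def)
  qed
  have disj: "consecutive ?A \<inter> consecutive ?B = {}" by (auto simp: consecutive_def)
  have A: "Min ?A = 0" "Max ?A = t" and B: "Min ?B = t" "Max ?B = L"
    using assms by (auto intro!: Min_eqI Max_eqI)
  have "sum ?g (consecutive ?A) =
      (\<Sum>(a, b)\<in>consecutive ?A. ((1 - t / L) * b - (1 - t / L) * a) * (f b - f a) / (b - a))"
    using assms(6,7)
    by (intro sum.cong refl) (auto simp: consecutive_def edge_green_def field_simps)
  also have "\<dots> = (1 - t / L) * (f t - f 0)"
    using assms by (subst sum_consecutive_affine) (auto simp: A)
  finally have sA: "sum ?g (consecutive ?A) = (1 - t / L) * (f t - f 0)" .
  have "sum ?g (consecutive ?B) =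
      (\<Sum>(a, b)\<in>consecutive ?B. (- (t / L) * b - - (t / L) * a) * (f b - f a) / (b - a))"
    using assms(6,7)
    by (intro sum.cong refl) (auto simp: consecutive_def edge_green_def field_simps)
  also have "\<dots> = - (t / L) * (f L - f t)"
    using assms by (subst sum_consecutive_affine) (auto simp: B)
  finally have sB: "sum ?g (consecutive ?B) = - (t / L) * (f L - f t)" .
  have "sum ?g (consecutive C) = sum ?g (consecutive ?A) + sum ?g (consecutive ?B)"
    unfolding split using assms(1)
    by (intro sum.union_disjoint finite_consecutive disj) auto
  then show ?thesis
    unfolding sA sB by (simp add: algebra_simps)
qed

text \<open>The antiderivative is expanded instead of written as
  \<open>(p + q * t) ^ 3 / (3 * q)\<close>, so that \<open>q = 0\<close> is covered.\<close>

lemma has_integral_affine_square: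
  fixes p q :: real
  assumes "a \<le> b"
  shows "((\<lambda>t. (p + q * t)\<^sup>2) has_integral
    (p\<^sup>2 * (b - a) + p * q * (b\<^sup>2 - a\<^sup>2) + q\<^sup>2 * (b ^ 3 - a ^ 3) / 3)) {a..b}"
proof -
  let ?F = "\<lambda>t. p\<^sup>2 * t + p * q * t\<^sup>2 + q\<^sup>2 * t ^ 3 / 3"
  have "((\<lambda>t. (p + q * t)\<^sup>2) has_integral (?F b - ?F a)) {a..b}"
    using assms
    by (intro fundamental_theorem_of_calculus)
      (auto intro!: derivative_eq_intros simp flip: has_real_derivative_iff_has_vector_derivative
        simp: power2_eq_square algebra_simps)
  then show ?thesis by (simp add: algebra_simps diff_divide_distrib)
qed

section \<open>Green's function of the metrized graph and the resistance function\<close>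

text \<open>
  Linear interpolation along the edges doubles as the pairing of \<open>f\<close> with the projection of the
  point mass at \<open>x\<close> to the end points of its edge.
\<close>

definition interpolate ::
  "('v, 'e) pre_digraph \<Rightarrow> ('e \<Rightarrow> real) \<Rightarrow> ('v \<Rightarrow> real) \<Rightarrow> ('v, 'e) gpoint \<Rightarrow> real" where
  "interpolate G len f x = (case x of Vertex v \<Rightarrow> f v
     | Inner e t \<Rightarrow> (1 - t / len e) * f (tail G e) + t / len e * f (head G e))"

lemma interpolate_simps [simp]:
  "interpolate G len f (Vertex v) = f v"
  "interpolate G len f (Inner e t) = (1 - t / len e) * f (tail G e) + t / len e * f (head G e)"
  by (simp_all add: interpolate_def)

fun local_green :: "('e \<Rightarrow> real) \<Rightarrow> ('v, 'e) gpoint \<Rightarrow> ('v, 'e) gpoint \<Rightarrow> real" where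
  "local_green len (Inner e s) (Inner e' t) = (if e = e' then edge_green (len e) s t else 0)"
| "local_green len _ _ = 0"

definition point_green ::
  "('v, 'e) pre_digraph \<Rightarrow> ('e \<Rightarrow> real) \<Rightarrow> ('v \<Rightarrow> 'v \<Rightarrow> real)
     \<Rightarrow> ('v, 'e) gpoint \<Rightarrow> ('v, 'e) gpoint \<Rightarrow> real" where
  "point_green G len k x y =
     interpolate G len (\<lambda>u. interpolate G len (\<lambda>w. k w u) y) x + local_green len x y"

text \<open>The kernel stands in for connectedness, so a rescaled kernel suffices to instantiate the
  locale for the graph with multiplied edges.\<close>

locale green_circuit = fin_digraph G
  for G :: "('v, 'e) pre_digraph" +
  fixes len :: "'e \<Rightarrow> real" and b :: 'v and k :: "'v \<Rightarrow> 'v \<Rightarrow> real"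
  assumes len_pos: "e \<in> arcs G \<Longrightarrow> len e > 0"
    and green: "grounded_green G len b k"
begin

lemma ground_in_verts: "b \<in> verts G"
  using green by (simp add: grounded_green_def)

lemma k_ground: "w \<in> verts G \<Longrightarrow> k w b = 0"
  using green by (simp add: grounded_green_def)

lemma dirichlet_form_k: "w \<in> verts G \<Longrightarrow> dirichlet_form G len (k w) f = f w - f b"
  using green by (simp add: grounded_green_def)

text \<open>By linearity, the interpolated kernel is the potential of a unit current that enters
  split between the two ends of the edge of \<open>x\<close>.\<close>

lemma dirichlet_form_interpolate:
  assumes "x \<in> gpoints G len"
  shows "dirichlet_form G len (\<lambda>u. interpolate G len (\<lambda>w. k w u) x) f = interpolate G len f x - f b"
proof (cases x)
  case (Vertex v)
  then show ?thesis using assms by (auto simp: gpoints_def dirichlet_form_k)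
next
  case (Inner e t)
  then have e: "e \<in> arcs G" using assms by (auto simp: gpoints_def)
  show ?thesis
    unfolding Inner interpolate_simps dirichlet_form_lincomb_left
    using e by (simp add: dirichlet_form_k algebra_simps)
qed

lemma interpolate_edge_point:
  assumes "e \<in> arcs G" "t \<in> {0..len e}"
  shows "interpolate G len f (edge_point G len e t) =
    (1 - t / len e) * f (tail G e) + t / len e * f (head G e)"
  using assms len_pos[OF assms(1)] by (auto simp: edge_point_def)

lemma edge_green_boundary:
  assumes "0 \<le> t" "t \<le> L"
  shows "edge_green L 0 t = 0" "edge_green L L t = 0"
  using assms by (auto simp: edge_green_def)

text \<open>\<open>edge_green\<close> vanishes at both ends of the edge, so the formula persists
  where \<open>edge_point\<close> is a vertex.\<close>

lemma local_green_edge_point: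
  assumes "e \<in> arcs G" "t \<in> {0..len e}" "Inner e s \<in> gpoints G len"
  shows "local_green len (edge_point G len e t) (Inner e s) = edge_green (len e) t s"
  using assms len_pos[OF assms(1)]
  by (auto simp: edge_point_def gpoints_def edge_green_boundary order_less_imp_le dest!: order_antisym)

lemma
  assumes "finite W" "W \<subseteq> gpoints G len" "e \<in> arcs G"
  shows finite_cuts: "finite (cuts len W e)"
    and cuts_subset: "cuts len W e \<subseteq> {0..len e}"
    and Min_cuts: "Min (cuts len W e) = 0"
    and Max_cuts: "Max (cuts len W e) = len e"
proof -
  have "finite {t. Inner e t \<in> W}"
    using finite_vimageI[OF assms(1), of "Inner e"] by (simp add: inj_def vimage_def)
  then show fin: "finite (cuts len W e)" by (simp add: cuts_def)
  show sub: "cuts len W e \<subseteq> {0..len e}"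
    using assms len_pos[OF assms(3)] by (fastforce simp: cuts_def gpoints_def)
  have "0 \<in> cuts len W e" "len e \<in> cuts len W e" by (auto simp: cuts_def)
  then show "Min (cuts len W e) = 0" "Max (cuts len W e) = len e"
    using fin sub by (auto intro!: Min_eqI Max_eqI)
qed

lemma arcs_subdivided:
  "arcs (subdivided G len W) = Sigma (arcs G) (\<lambda>e. consecutive (cuts len W e))"
  by (auto simp: subdivided_def consecutive_def)

lemma fin_digraph_subdivided:
  assumes "finite W" "W \<subseteq> gpoints G len"
  shows "fin_digraph (subdivided G len W)"
proof
  have pt: "edge_point G len e t \<in> verts (subdivided G len W)"
    if "e \<in> arcs G" "t \<in> cuts len W e" for e t
    using that by (auto simp: edge_point_def subdivided_def cuts_def)
  show "tail (subdivided G len W) a \<in> verts (subdivided G len W)"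
    "head (subdivided G len W) a \<in> verts (subdivided G len W)"
    if "a \<in> arcs (subdivided G len W)" for a
    using that pt unfolding arcs_subdivided
    by (auto simp: consecutive_def subdivided_def)
  show "finite (verts (subdivided G len W))"
    using assms by (simp add: subdivided_def)
  show "finite (arcs (subdivided G len W))"
    unfolding arcs_subdivided
    using finite_consecutive[OF finite_cuts[OF assms]] by auto
qed

lemma dirichlet_form_subdivided:
  assumes "finite W"
  shows "dirichlet_form (subdivided G len W) segment_resistance f g =
    (\<Sum>e\<in>arcs G. \<Sum>(s, t)\<in>consecutive (cuts len W e).
      (f (edge_point G len e t) - f (edge_point G len e s)) *
      (g (edge_point G len e t) - g (edge_point G len e s)) / (t - s))"
proof -
  have fin: "finite (consecutive (cuts len W e))" for e
  proof -
    have "finite {t. Inner e t \<in> W}"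
      using finite_vimageI[OF assms(1), of "Inner e"] by (simp add: inj_def vimage_def)
    then show ?thesis by (intro finite_consecutive) (simp add: cuts_def)
  qed
  show ?thesis
    unfolding dirichlet_form_def arcs_subdivided
    by (subst sum.Sigma) (auto simp: fin subdivided_def segment_resistance_def intro!: sum.cong)
qed

text \<open>The interpolated part is affine on each edge and sees only the vertex values of
  \<open>f\<close>; it yields the interpolation of \<open>f\<close> at \<open>x\<close> minus the
  value at the ground. The local part yields \<open>f x\<close> minus that interpolation, and the
  two interpolations cancel.\<close>

lemma dirichlet_form_point_green:
  assumes W: "finite W" "W \<subseteq> gpoints G len" and x: "x \<in> W"
  shows "dirichlet_form (subdivided G len W) segment_resistance (\<lambda>z. point_green G len k z x) f =
    f x - f (Vertex b)"
proof -
  let ?p = "edge_point G len"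
  define h where "h = (\<lambda>u. interpolate G len (\<lambda>w. k w u) x)"
  have xg: "x \<in> gpoints G len" using W x by blast
  have ends: "?p e 0 = Vertex (tail G e)" "?p e (len e) = Vertex (head G e)" if "e \<in> arcs G" for e
    using len_pos[OF that] by (auto simp: edge_point_def)
  have pg: "point_green G len k z x = interpolate G len h z + local_green len z x" for z
    by (simp add: point_green_def h_def)
  have lin: "dirichlet_form (subdivided G len W) segment_resistance (interpolate G len h) f =
      dirichlet_form G len h (\<lambda>v. f (Vertex v))"
  proof -
    have "(\<Sum>(s, t)\<in>consecutive (cuts len W e).
        (interpolate G len h (?p e t) - interpolate G len h (?p e s)) *
        (f (?p e t) - f (?p e s)) / (t - s)) =
      (h (head G e) - h (tail G e)) * (f (Vertex (head G e)) - f (Vertex (tail G e))) / len e"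
      (is "?l = ?r") if e: "e \<in> arcs G" for e
    proof -
      have ne: "cuts len W e \<noteq> {}" by (auto simp: cuts_def)
      let ?q = "(h (head G e) - h (tail G e)) / len e"
      have "?l = (\<Sum>(s, t)\<in>consecutive (cuts len W e).
        (?q * t - ?q * s) * (f (?p e t) - f (?p e s)) / (t - s))"
      proof (intro sum.cong refl, clarify)
        fix s t assume "(s, t) \<in> consecutive (cuts len W e)"
        then have "s \<in> {0..len e}" "t \<in> {0..len e}"
          using cuts_subset[OF W e] by (auto simp: consecutive_def)
        then have "interpolate G len h (?p e t) - interpolate G len h (?p e s) = ?q * t - ?q * s"
          unfolding interpolate_edge_point[OF e \<open>s \<in> _\<close>] interpolate_edge_point[OF e \<open>t \<in> _\<close>]
          using len_pos[OF e] by (simp add: field_simps)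
        then show "(interpolate G len h (?p e t) - interpolate G len h (?p e s)) *
            (f (?p e t) - f (?p e s)) / (t - s) = (?q * t - ?q * s) * (f (?p e t) - f (?p e s)) / (t - s)"
          by simp
      qed
      also have "\<dots> = ?r"
        unfolding sum_consecutive_affine[OF finite_cuts[OF W e] ne, of _ "\<lambda>t. f (?p e t)"]
          Min_cuts[OF W e] Max_cuts[OF W e] ends[OF e] by simp
      finally show ?thesis .
    qed
    then show ?thesis
      unfolding dirichlet_form_subdivided[OF W(1)] by (simp add: dirichlet_form_def)
  qed
  have loc: "dirichlet_form (subdivided G len W) segment_resistance (\<lambda>z. local_green len z x) f =
      f x - interpolate G len (\<lambda>v. f (Vertex v)) x"
  proof (cases x)
    case (Vertex v)
    then have "local_green len z x = 0" for z by (cases z) auto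
    then show ?thesis using Vertex by (simp add: dirichlet_form_def)
  next
    case (Inner e0 t0)
    have e0: "e0 \<in> arcs G" "0 < t0" "t0 < len e0"
      using xg Inner by (auto simp: gpoints_def)
    have "(\<Sum>(s, t)\<in>consecutive (cuts len W e).
        (local_green len (?p e t) x - local_green len (?p e s) x) *
        (f (?p e t) - f (?p e s)) / (t - s)) =
      (if e = e0 then f x - interpolate G len (\<lambda>v. f (Vertex v)) x else 0)"
      (is "?l = ?r") if e: "e \<in> arcs G" for e
    proof (cases "e = e0")
      case True
      have "?l = (\<Sum>(s, t)\<in>consecutive (cuts len W e).
        (edge_green (len e) t t0 - edge_green (len e) s t0) * (f (?p e t) - f (?p e s)) / (t - s))"
      proof (intro sum.cong refl, clarify)
        fix s t assume "(s, t) \<in> consecutive (cuts len W e)"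
        then have st: "s \<in> {0..len e}" "t \<in> {0..len e}"
          using cuts_subset[OF W e] by (auto simp: consecutive_def)
        have "Inner e t0 \<in> gpoints G len" using xg Inner True by simp
        from local_green_edge_point[OF e st(1) this] local_green_edge_point[OF e st(2) this]
        show "(local_green len (?p e t) x - local_green len (?p e s) x) *
            (f (?p e t) - f (?p e s)) / (t - s) =
          (edge_green (len e) t t0 - edge_green (len e) s t0) * (f (?p e t) - f (?p e s)) / (t - s)"
          using Inner True by simp
      qed
      also have "\<dots> = f (?p e t0) - ((1 - t0 / len e) * f (?p e 0) + t0 / len e * f (?p e (len e)))"
        using e0 x Inner True
        by (intro sum_consecutive_edge_green finite_cuts[OF W e] cuts_subset[OF W e])
          (auto simp: cuts_def)
      also have "\<dots> = ?r"
        unfolding ends[OF e] using True Inner e0 by (simp add: edge_point_def)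
      finally show ?thesis .
    next
      case False
      then have "local_green len (?p e t) x = 0" for t
        using Inner by (auto simp: edge_point_def)
      then show ?thesis using False by simp
    qed
    then show ?thesis
      unfolding dirichlet_form_subdivided[OF W(1)] using e0(1) by simp
  qed
  have "dirichlet_form (subdivided G len W) segment_resistance (\<lambda>z. point_green G len k z x) f =
      dirichlet_form (subdivided G len W) segment_resistance (interpolate G len h) f +
      dirichlet_form (subdivided G len W) segment_resistance (\<lambda>z. local_green len z x) f"
    unfolding pg using dirichlet_form_lincomb_left[of _ _ 1 "interpolate G len h" 1] by simp
  also have "\<dots> = f x - f (Vertex b)"
    unfolding lin loc using dirichlet_form_interpolate[OF xg] by (simp add: h_def)
  finally show ?thesis .
qed

text \<open>Superposition: the difference of the potentials with sources at \<open>x\<close> and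
  \<open>y\<close> carries unit current from \<open>x\<close> to \<open>y\<close>, the sinks at the
  ground cancelling.\<close>

lemma resistance_eq_point_green:
  assumes "x \<in> gpoints G len" "y \<in> gpoints G len"
  shows "resistance G len x y = point_green G len k x x - point_green G len k x y -
    (point_green G len k y x - point_green G len k y y)"
  unfolding resistance_def
proof (rule effective_resistance_eqI)
  have W: "finite {x, y}" "{x, y} \<subseteq> gpoints G len" using assms by auto
  show fd: "fin_digraph (subdivided G len {x, y})"
    using W by (rule fin_digraph_subdivided)
  show "x \<in> verts (subdivided G len {x, y})" "y \<in> verts (subdivided G len {x, y})"
    by (auto simp: subdivided_def)
  show "unit_current_potential (subdivided G len {x, y}) segment_resistance x y
      (\<lambda>z. point_green G len k z x - point_green G len k z y)"
    unfolding unit_current_potential_def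
  proof
    fix u assume u: "u \<in> verts (subdivided G len {x, y})"
    show "net_current (subdivided G len {x, y}) segment_resistance
        (\<lambda>z. point_green G len k z x - point_green G len k z y) u = of_bool (u = x) - of_bool (u = y)"
      unfolding net_current_eq_dirichlet_form[OF fd u] dirichlet_form_diff_left
        dirichlet_form_point_green[OF W insertI1]
        dirichlet_form_point_green[OF W insertI2[OF singletonI]]
      by (simp add: of_bool_def)
  qed
qed

lemma point_green_commute:
  assumes "x \<in> gpoints G len" "y \<in> gpoints G len"
  shows "point_green G len k x y = point_green G len k y x"
proof -
  have k: "k u w = k w u" if "u \<in> verts G" "w \<in> verts G" for u w
    using grounded_green_commute[OF green that] .
  show ?thesis
    using assms
    by (auto simp: gpoints_def point_green_def edge_green_def k min.commute max.commute
        algebra_simps add_divide_distrib diff_divide_distrib)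
qed

section \<open>Slope of the resistance along an edge and the integral of its square\<close>

text \<open>The effective resistance in the whole graph between the two ends of \<open>e\<close>,
  expressed by the kernel.\<close>

definition edge_resistance :: "'e \<Rightarrow> real" where
  "edge_resistance e =
     k (tail G e) (tail G e) + k (head G e) (head G e) - 2 * k (tail G e) (head G e)"

text \<open>The average of the derivative of the resistance to \<open>y\<close> over
  \<open>e\<close>: the increment between the two ends, divided by the length.\<close>

definition mean_slope :: "('v, 'e) gpoint \<Rightarrow> 'e \<Rightarrow> real" where
  "mean_slope y e =
     ((k (head G e) (head G e) - k (tail G e) (tail G e))
      - 2 * (interpolate G len (\<lambda>w. k w (head G e)) y - interpolate G len (\<lambda>w. k w (tail G e)) y))
     / len e"

text \<open>Slope of the edge Green's function with pole \<open>t'\<close>; the value at the kink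
  \<open>t = t'\<close> is a mere convention.\<close>

definition local_slope :: "('v, 'e) gpoint \<Rightarrow> 'e \<Rightarrow> real \<Rightarrow> real" where
  "local_slope y e t = (case y of Vertex v \<Rightarrow> 0
     | Inner e' t' \<Rightarrow> if e' = e then (if t < t' then 1 - t' / len e else - t' / len e) else 0)"

lemma local_green_has_derivative:
  assumes "e \<in> arcs G" "y \<in> gpoints G len" "0 < t" "t < len e" "y \<noteq> Inner e t"
  shows "((\<lambda>s. local_green len (Inner e s) y) has_real_derivative local_slope y e t) (at t)"
proof (cases "\<exists>t'. y = Inner e t'")
  case False
  then have "local_green len (Inner e s) y = 0" for s by (cases y) auto
  moreover have "local_slope y e t = 0"
    using False by (auto simp: local_slope_def split: gpoint.split)
  ultimately show ?thesis by simp
next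
  case True
  then obtain t' where y: "y = Inner e t'" by blast
  have t': "0 < t'" "t' < len e" using assms(2) y by (auto simp: gpoints_def)
  consider "t < t'" | "t > t'" using assms(5) y by fastforce
  then show ?thesis
  proof cases
    case 1
    have "((\<lambda>s. s * (len e - t') / len e) has_real_derivative (1 - t' / len e)) (at t)"
      using t' by (auto intro!: derivative_eq_intros simp: field_simps)
    then have "((\<lambda>s. local_green len (Inner e s) y) has_real_derivative (1 - t' / len e)) (at t)"
      by (rule has_field_derivative_transform_within_open[where S = "{..<t'}"])
        (use 1 in \<open>auto simp: y edge_green_def\<close>)
    then show ?thesis using 1 by (simp add: local_slope_def y)
  next
    case 2
    have "((\<lambda>s. t' * (len e - s) / len e) has_real_derivative (- t' / len e)) (at t)"
      using t' by (auto intro!: derivative_eq_intros simp: field_simps)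
    then have "((\<lambda>s. local_green len (Inner e s) y) has_real_derivative (- t' / len e)) (at t)"
      by (rule has_field_derivative_transform_within_open[where S = "{t'<..}"])
        (use 2 in \<open>auto simp: y edge_green_def\<close>)
    then show ?thesis using 2 by (simp add: local_slope_def y)
  qed
qed

text \<open>Along the edge, the diagonal of \<open>point_green\<close> is the linear interpolation
  of its end values plus a parabola with coefficient \<open>len e - edge_resistance e\<close>, whose
  derivative is the middle term. At \<open>y\<close> itself the slope jumps, hence the
  exclusion.\<close>

lemma deriv_resistance:
  assumes "e \<in> arcs G" "y \<in> gpoints G len" "0 < t" "t < len e" "y \<noteq> Inner e t"
  shows "deriv (\<lambda>s. resistance G len (edge_point G len e s) y) t =
    mean_slope y e + (1 - edge_resistance e / len e) * (1 - 2 * t / len e) - 2 * local_slope y e t"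
proof -
  let ?L = "len e" and ?u = "tail G e" and ?v = "head G e"
  define h where "h u = interpolate G len (\<lambda>w. k w u) y" for u
  define R where "R s = (1 - s / ?L) * k ?u ?u + s / ?L * k ?v ?v
      + s / ?L * (1 - s / ?L) * (?L - edge_resistance e)
      + point_green G len k y y - 2 * ((1 - s / ?L) * h ?u + s / ?L * h ?v)
      - 2 * local_green len (Inner e s) y" for s
  have L: "?L > 0" using len_pos assms(1) by simp
  have R: "R s = resistance G len (edge_point G len e s) y" if "s \<in> {0<..<?L}" for s
  proof -
    have ep: "edge_point G len e s = Inner e s" using that by (simp add: edge_point_def)
    have sp: "Inner e s \<in> gpoints G len" using that assms(1) by (simp add: gpoints_def)
    have kc: "k ?v ?u = k ?u ?v"
      using grounded_green_commute[OF green] assms(1) by simp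
    have "point_green G len k (Inner e s) (Inner e s) =
        (1 - s / ?L) * k ?u ?u + s / ?L * k ?v ?v + s / ?L * (1 - s / ?L) * (?L - edge_resistance e)"
      using L by (simp add: point_green_def edge_green_def edge_resistance_def kc field_simps)
    moreover have "point_green G len k (Inner e s) y =
        (1 - s / ?L) * h ?u + s / ?L * h ?v + local_green len (Inner e s) y"
      by (simp add: point_green_def h_def)
    ultimately show ?thesis
      unfolding ep resistance_eq_point_green[OF sp assms(2)]
        point_green_commute[OF assms(2) sp] R_def by simp
  qed
  have "(R has_real_derivative
      mean_slope y e + (1 - edge_resistance e / ?L) * (1 - 2 * t / ?L) - 2 * local_slope y e t) (at t)"
    unfolding R_def mean_slope_def h_def[symmetric] using L
    by (auto intro!: derivative_eq_intros local_green_has_derivative[OF assms] simp: field_simps)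
  then have "((\<lambda>s. resistance G len (edge_point G len e s) y) has_real_derivative
      mean_slope y e + (1 - edge_resistance e / ?L) * (1 - 2 * t / ?L) - 2 * local_slope y e t) (at t)"
    by (rule has_field_derivative_transform_within_open[where S = "{0<..<?L}"])
      (use assms(3,4) R in auto)
  then show ?thesis by (rule DERIV_imp_deriv)
qed

text \<open>The contribution of a pole \<open>y\<close> inside \<open>e\<close> to the integral
  below. Summed over all edges it compensates the dependence of the mean slopes on
  \<open>y\<close>.\<close>

definition local_energy :: "('v, 'e) gpoint \<Rightarrow> 'e \<Rightarrow> real" where
  "local_energy y e = (case y of Vertex v \<Rightarrow> 0
     | Inner e' t' \<Rightarrow> if e' = e then edge_resistance e * (t' / len e * (1 - t' / len e)) else 0)"

text \<open>The parabola and pole terms have mean zero, so the mean slope splits off. With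
  \<open>\<sigma> = t' / len e\<close>, the square of the local slope and its product with
  \<open>1 - 2 * t / len e\<close> both integrate to
  \<open>len e * \<sigma> * (1 - \<sigma>)\<close>, which together produce the factor
  \<open>edge_resistance e\<close>. The proof checks this by integrating the affine pieces.\<close>

lemma integral_deriv_resistance_square:
  assumes e: "e \<in> arcs G" and y: "y \<in> gpoints G len"
  shows "integral {0..len e} (\<lambda>t. (deriv (\<lambda>s. resistance G len (edge_point G len e s) y) t)\<^sup>2) =
    len e * (mean_slope y e)\<^sup>2 + (len e - edge_resistance e)\<^sup>2 / (3 * len e) + 4 * local_energy y e"
proof -
  let ?D = "\<lambda>t. (deriv (\<lambda>s. resistance G len (edge_point G len e s) y) t)\<^sup>2"
  let ?L = "len e" and ?m = "mean_slope y e"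
  define \<beta> where "\<beta> = 1 - edge_resistance e / ?L"
  have L: "?L > 0" using len_pos e by simp
  \<comment> \<open>\<open>q\<close> is the slope of the derivative on each piece. Writing
    \<open>\<beta>\<close> through \<open>q\<close>, and later \<open>t'\<close> through
    \<open>\<sigma>\<close>, turns the final identities into polynomial ones.\<close>
  define q where "q = - 2 * \<beta> / ?L"
  have \<beta>_q: "\<beta> = - (q * ?L / 2)" using L by (simp add: q_def)
  have er: "edge_resistance e = ?L * (1 - \<beta>)" using L by (simp add: \<beta>_def)
  have er_term: "(?L - edge_resistance e)\<^sup>2 / (3 * ?L) = ?L * \<beta>\<^sup>2 / 3"
    using L by (simp add: er power2_eq_square field_simps)
  have D: "?D t = (?m + \<beta> * (1 - 2 * t / ?L) - 2 * local_slope y e t)\<^sup>2"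
    if "0 < t" "t < ?L" "y \<noteq> Inner e t" for t
    using deriv_resistance[OF e y that] by (simp add: \<beta>_def)
  \<comment> \<open>On an interval where the local slope is a constant \<open>c\<close> the
    derivative is affine; the end points, where \<open>deriv\<close> may be meaningless, form a
    finite exceptional set.\<close>
  have piece: "(?D has_integral ((?m + \<beta> - 2 * c)\<^sup>2 * (b' - a) + (?m + \<beta> - 2 * c) * q * (b'\<^sup>2 - a\<^sup>2)
      + q\<^sup>2 * (b' ^ 3 - a ^ 3) / 3)) {a..b'}"
    if ab: "0 \<le> a" "a \<le> b'" "b' \<le> ?L"
      and c: "\<And>t. a < t \<Longrightarrow> t < b' \<Longrightarrow> local_slope y e t = c \<and> y \<noteq> Inner e t" for a b' c
  proof (rule has_integral_spike_finite[OF _ _ has_integral_affine_square[OF ab(2)]])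
    show "finite {a, b'}" by simp
    fix t assume "t \<in> {a..b'} - {a, b'}"
    then have "0 < t" "t < ?L" "local_slope y e t = c" "y \<noteq> Inner e t" using ab c by auto
    then have "?D t = (?m + \<beta> * (1 - 2 * t / ?L) - 2 * c)\<^sup>2" using D by simp
    also have "?m + \<beta> * (1 - 2 * t / ?L) - 2 * c = ?m + \<beta> - 2 * c + q * t"
      by (simp add: q_def algebra_simps)
    finally show "?D t = (?m + \<beta> - 2 * c + q * t)\<^sup>2" .
  qed
  show ?thesis
  proof (cases "\<exists>t'. y = Inner e t'")
    case False
    then have c: "local_slope y e t = 0 \<and> y \<noteq> Inner e t" for t
      by (auto simp: local_slope_def split: gpoint.split)
    have le: "local_energy y e = 0"
      using False by (auto simp: local_energy_def split: gpoint.split)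
    have "integral {0..?L} ?D = (?m + \<beta> - 2 * 0)\<^sup>2 * (?L - 0) +
        (?m + \<beta> - 2 * 0) * q * (?L\<^sup>2 - 0\<^sup>2) + q\<^sup>2 * (?L ^ 3 - 0 ^ 3) / 3"
      by (intro integral_unique piece) (use L c in auto)
    then show ?thesis
      unfolding le er_term \<beta>_q by (simp add: algebra_simps power2_eq_square power3_eq_cube)
  next
    case True
    then obtain t' where y': "y = Inner e t'" by blast
    define \<sigma> where "\<sigma> = t' / ?L"
    have t': "0 < t'" "t' < ?L" using y y' by (auto simp: gpoints_def)
    have t'_eq: "t' = ?L * \<sigma>" using L by (simp add: \<sigma>_def)
    have 1: "local_slope y e t = 1 - \<sigma> \<and> y \<noteq> Inner e t" if "t < t'" for t
      using that by (simp add: local_slope_def y' \<sigma>_def)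
    have 2: "local_slope y e t = - \<sigma> \<and> y \<noteq> Inner e t" if "t' < t" for t
      using that by (simp add: local_slope_def y' \<sigma>_def)
    have le: "local_energy y e = edge_resistance e * (\<sigma> * (1 - \<sigma>))"
      by (simp add: local_energy_def y' \<sigma>_def)
    note I = has_integral_combine[OF less_imp_le less_imp_le
        piece[of 0 t' "1 - \<sigma>"] piece[of t' ?L "- \<sigma>"], OF t']
    have "integral {0..?L} ?D = ((?m + \<beta> - 2 * (1 - \<sigma>))\<^sup>2 * (t' - 0) +
        (?m + \<beta> - 2 * (1 - \<sigma>)) * q * (t'\<^sup>2 - 0\<^sup>2) +
        q\<^sup>2 * (t' ^ 3 - 0 ^ 3) / 3) +
       ((?m + \<beta> - 2 * - \<sigma>)\<^sup>2 * (?L - t') +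
        (?m + \<beta> - 2 * - \<sigma>) * q * (?L\<^sup>2 - t'\<^sup>2) +
        q\<^sup>2 * (?L ^ 3 - t' ^ 3) / 3)"
      by (intro integral_unique I) (use t' 1 2 in auto)
    also have "\<dots> = ?L * ?m\<^sup>2 + ?L * \<beta>\<^sup>2 / 3 + 4 * (?L * (1 - \<beta>) * (\<sigma> * (1 - \<sigma>)))"
      unfolding \<beta>_q t'_eq by (simp add: field_simps power2_eq_square power3_eq_cube)
    finally show ?thesis unfolding le er_term unfolding er .
  qed
qed

section \<open>Closed formula for the tau constant\<close>

text \<open>The mean slopes are difference quotients of \<open>d - 2 h\<close>, so their squares sum
  to its energy. The reproducing property turns the terms involving \<open>h\<close> into values at
  \<open>y\<close>, and the local energies cancel exactly these.\<close>

lemma tau_at_eq: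
  assumes y: "y \<in> gpoints G len"
  shows "tau_at G len y = 1 / 4 * (dirichlet_form G len (\<lambda>u. k u u) (\<lambda>u. k u u)
    + (\<Sum>e\<in>arcs G. (len e - edge_resistance e)\<^sup>2 / (3 * len e)))"
proof -
  define d where "d = (\<lambda>u. k u u)"
  define h where "h = (\<lambda>u. interpolate G len (\<lambda>w. k w u) y)"
  have hb: "h b = 0"
    using y k_ground by (auto simp: h_def gpoints_def)
  have db: "d b = 0"
    using k_ground ground_in_verts by (simp add: d_def)
  have "(\<Sum>e\<in>arcs G. len e * (mean_slope y e)\<^sup>2) =
      dirichlet_form G len (\<lambda>u. d u - 2 * h u) (\<lambda>u. d u - 2 * h u)"
    unfolding dirichlet_form_def
  proof (intro sum.cong refl)
    fix e assume "e \<in> arcs G"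
    then have "len e > 0" by (rule len_pos)
    then show "len e * (mean_slope y e)\<^sup>2 =
      (d (head G e) - 2 * h (head G e) - (d (tail G e) - 2 * h (tail G e))) *
      (d (head G e) - 2 * h (head G e) - (d (tail G e) - 2 * h (tail G e))) / len e"
      unfolding mean_slope_def d_def h_def by (simp add: power2_eq_square field_simps)
  qed
  also have "\<dots> = dirichlet_form G len d d - 4 * dirichlet_form G len h d + 4 * dirichlet_form G len h h"
    unfolding dirichlet_form_def sum_distrib_left sum_subtractf[symmetric] sum.distrib[symmetric]
    by (intro sum.cong refl) (simp add: algebra_simps diff_divide_distrib add_divide_distrib)
  also have "dirichlet_form G len h d = interpolate G len d y"
    using dirichlet_form_interpolate[OF y, of d] db by (simp add: h_def)
  also have "dirichlet_form G len h h = interpolate G len h y"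
    using dirichlet_form_interpolate[OF y, of h] hb by (simp add: h_def)
  finally have slopes: "(\<Sum>e\<in>arcs G. len e * (mean_slope y e)\<^sup>2) =
      dirichlet_form G len d d - 4 * interpolate G len d y + 4 * interpolate G len h y" .
  \<comment> \<open>Interpolating the diagonal of \<open>k\<close> linearly exceeds interpolating
    \<open>k\<close> in both arguments by this amount; at a vertex the two agree.\<close>
  have "(\<Sum>e\<in>arcs G. local_energy y e) = interpolate G len d y - interpolate G len h y"
  proof (cases y)
    case (Vertex v)
    then show ?thesis by (simp add: local_energy_def d_def h_def)
  next
    case (Inner e t)
    have e: "e \<in> arcs G" using y Inner by (simp add: gpoints_def image_def)
    have kc: "k (head G e) (tail G e) = k (tail G e) (head G e)"
      using grounded_green_commute[OF green] e by simp
    have "(\<Sum>e'\<in>arcs G. local_energy y e') = edge_resistance e * (t / len e * (1 - t / len e))"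
      using e by (simp add: local_energy_def Inner)
    also have "\<dots> = interpolate G len d y - interpolate G len h y"
      using len_pos[OF e]
      by (simp add: Inner d_def h_def edge_resistance_def kc field_simps)
    finally show ?thesis .
  qed
  with slopes show ?thesis
    unfolding tau_at_def
    by (simp add: integral_deriv_resistance_square[OF _ y] sum.distrib sum_distrib_left[symmetric] d_def)
qed

lemma tau_eq:
  "tau G len = 1 / 4 * (dirichlet_form G len (\<lambda>u. k u u) (\<lambda>u. k u u)
    + (\<Sum>e\<in>arcs G. (len e - edge_resistance e)\<^sup>2 / (3 * len e)))"
  unfolding tau_def
proof (rule the_equality)
  have "Vertex b \<in> gpoints G len" using ground_in_verts by (simp add: gpoints_def)
  then show "\<forall>y\<in>gpoints G len. tau_at G len y = c \<Longrightarrow>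
      c = 1 / 4 * (dirichlet_form G len (\<lambda>u. k u u) (\<lambda>u. k u u)
        + (\<Sum>e\<in>arcs G. (len e - edge_resistance e)\<^sup>2 / (3 * len e)))" for c
    using tau_at_eq[of "Vertex b"] by auto
qed (simp add: tau_at_eq)

end

section \<open>Replacing every edge by \<open>n\<close> shorter parallel edges\<close>

lemma sum_arcs_DA:
  "(\<Sum>a\<in>arcs (DA_graph n G). F (fst a)) = real n * (\<Sum>e\<in>arcs G. F e)"
  unfolding DA_graph_def
  by (simp add: sum.cartesian_product'[of _ "arcs G" "{..<n}"] sum_distrib_left)

text \<open>One factor \<open>n\<close> comes from the number of copies, the other from the
  conductance of each copy.\<close>

lemma dirichlet_form_DA:
  "dirichlet_form (DA_graph n G) (DA_length n len) f g = (real n)\<^sup>2 * dirichlet_form G len f g"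
proof -
  define F where "F e = (f (head G e) - f (tail G e)) * (g (head G e) - g (tail G e))
    / (len e / real n)" for e
  have "dirichlet_form (DA_graph n G) (DA_length n len) f g =
    (\<Sum>a\<in>arcs (DA_graph n G). F (fst a))"
    unfolding dirichlet_form_def F_def
    by (intro sum.cong refl) (simp add: DA_graph_def DA_length_def case_prod_unfold)
  also have "\<dots> = (real n)\<^sup>2 * dirichlet_form G len f g"
    unfolding sum_arcs_DA unfolding dirichlet_form_def sum_distrib_left F_def
    by (intro sum.cong refl) (simp add: power2_eq_square mult_ac)
  finally show ?thesis .
qed

lemma dirichlet_form_divide_left:
  "dirichlet_form H R (\<lambda>u. f u / c) g = dirichlet_form H R f g / c"
  using dirichlet_form_lincomb_left[of H R "1 / c" f 0 f g] by simp

lemma green_circuit_DA: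
  assumes "green_circuit G len b k" "n > 0"
  shows "green_circuit (DA_graph n G) (DA_length n len) b (\<lambda>w u. k w u / (real n)\<^sup>2)"
proof -
  interpret green_circuit G len b k by fact
  show ?thesis
  proof
    show "tail (DA_graph n G) a \<in> verts (DA_graph n G)" "head (DA_graph n G) a \<in> verts (DA_graph n G)"
      if "a \<in> arcs (DA_graph n G)" for a
      using that by (auto simp: DA_graph_def)
    show "finite (verts (DA_graph n G))" "finite (arcs (DA_graph n G))"
      by (auto simp: DA_graph_def)
    show "0 < DA_length n len a" if "a \<in> arcs (DA_graph n G)" for a
      using that assms(2) len_pos by (auto simp: DA_graph_def DA_length_def)
    have "verts (DA_graph n G) = verts G" by (simp add: DA_graph_def)
    then show "grounded_green (DA_graph n G) (DA_length n len) b (\<lambda>w u. k w u / (real n)\<^sup>2)"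
      using green assms(2)
      by (simp add: grounded_green_def dirichlet_form_divide_left dirichlet_form_DA)
  qed
qed

text \<open>The kernel shrinks by \<open>n\<^sup>2\<close> while the form grows by
  \<open>n\<^sup>2\<close>, so the energy of the diagonal is divided by \<open>n\<^sup>2\<close>. In
  the edge sum, the \<open>n\<close> copies together compensate the shorter length in the
  denominator.\<close>

lemma (in green_circuit) tau_DA_eq:
  assumes "n > 0"
  shows "tau (DA_graph n G) (DA_length n len) =
    1 / 4 * (dirichlet_form G len (\<lambda>u. k u u) (\<lambda>u. k u u) / (real n)\<^sup>2
    + (\<Sum>e\<in>arcs G. (len e - edge_resistance e / real n)\<^sup>2 / (3 * len e)))"
proof -
  interpret DA: green_circuit "DA_graph n G" "DA_length n len" b "\<lambda>w u. k w u / (real n)\<^sup>2"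
    using green_circuit_DA[OF green_circuit_axioms assms] .
  have r: "DA.edge_resistance a = edge_resistance (fst a) / (real n)\<^sup>2" for a
    unfolding DA.edge_resistance_def edge_resistance_def
    by (simp add: DA_graph_def case_prod_unfold add_divide_distrib diff_divide_distrib)
  have form: "dirichlet_form (DA_graph n G) (DA_length n len)
      (\<lambda>u. k u u / (real n)\<^sup>2) (\<lambda>u. k u u / (real n)\<^sup>2) =
      dirichlet_form G len (\<lambda>u. k u u) (\<lambda>u. k u u) / (real n)\<^sup>2"
    using assms
    by (simp add: dirichlet_form_DA dirichlet_form_divide_left
        dirichlet_form_commute[of _ _ _ "\<lambda>u. k u u / (real n)\<^sup>2"])
  define F where "F e = (len e / real n - edge_resistance e / (real n)\<^sup>2)\<^sup>2 / (3 * (len e / real n))"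
    for e
  have "(\<Sum>a\<in>arcs (DA_graph n G). (DA_length n len a - DA.edge_resistance a)\<^sup>2 / (3 * DA_length n len a)) =
      (\<Sum>a\<in>arcs (DA_graph n G). F (fst a))"
    by (simp add: r F_def DA_length_def case_prod_unfold)
  also have "\<dots> = (\<Sum>e\<in>arcs G. (len e - edge_resistance e / real n)\<^sup>2 / (3 * len e))"
    unfolding sum_arcs_DA unfolding sum_distrib_left F_def
  proof (intro sum.cong refl)
    fix e assume "e \<in> arcs G"
    then have "len e > 0" by (rule len_pos)
    then show "real n * ((len e / real n - edge_resistance e / (real n)\<^sup>2)\<^sup>2 / (3 * (len e / real n))) =
        (len e - edge_resistance e / real n)\<^sup>2 / (3 * len e)"
      using assms by (simp add: power2_eq_square field_simps)
  qed
  finally show ?thesis unfolding DA.tau_eq form by simp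
qed

section \<open>Case distinction on the sum of the edge resistances\<close>

theorem theorem3p11:
  fixes G :: "('v, 'e) pre_digraph" and len :: "'e \<Rightarrow> real" and n :: nat
  assumes "metrized_graph G len"
    and "total_length G len = 1"
    and "n \<ge> 2"
    and "tau (DA_graph n G) (DA_length n len) \<ge> 1 / 108 * ((3 * real n - 2) / real n)\<^sup>2"
  shows "tau G len \<ge> 1 / 108"
proof -
  obtain b k where "grounded_green G len b k"
    using grounded_green_exists[OF assms(1)] by blast
  then interpret green_circuit G len b k
    using assms(1)
    by (simp add: green_circuit_def green_circuit_axioms_def metrized_graph_def)
  define Q where "Q = dirichlet_form G len (\<lambda>u. k u u) (\<lambda>u. k u u)"
  define S where "S = (\<Sum>e\<in>arcs G. edge_resistance e)"
  define P where "P = (\<Sum>e\<in>arcs G. (edge_resistance e)\<^sup>2 / len e)"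
  have Q: "Q \<ge> 0"
    unfolding Q_def dirichlet_form_def using len_pos
    by (intro sum_nonneg) (simp add: order_less_imp_le)
  have one: "(\<Sum>e\<in>arcs G. len e) = 1"
    using assms(2) by (simp add: total_length_def)
  \<comment> \<open>\<open>c = 1\<close> serves the graph itself, \<open>c = 1 / real n\<close> the
    graph with multiplied edges.\<close>
  have expand: "(\<Sum>e\<in>arcs G. (len e - edge_resistance e * c)\<^sup>2 / (3 * len e)) =
      (1 - 2 * c * S + c\<^sup>2 * P) / 3" for c
  proof -
    have "(\<Sum>e\<in>arcs G. (len e - edge_resistance e * c)\<^sup>2 / (3 * len e)) =
        (\<Sum>e\<in>arcs G. (len e - 2 * c * edge_resistance e + c\<^sup>2 * ((edge_resistance e)\<^sup>2 / len e)) / 3)"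
    proof (intro sum.cong refl)
      fix e assume "e \<in> arcs G"
      then have "len e > 0" by (rule len_pos)
      then show "(len e - edge_resistance e * c)\<^sup>2 / (3 * len e) =
        (len e - 2 * c * edge_resistance e + c\<^sup>2 * ((edge_resistance e)\<^sup>2 / len e)) / 3"
        by (simp add: power2_eq_square field_simps)
    qed
    also have "\<dots> = (1 - 2 * c * S + c\<^sup>2 * P) / 3"
      by (simp del: times_divide_eq_right add: sum_divide_distrib[symmetric] sum.distrib sum_subtractf
          sum_distrib_left[symmetric] one S_def P_def)
    finally show ?thesis .
  qed
  have tau: "4 * tau G len = Q + (1 - 2 * S + P) / 3"
    using expand[of 1] by (simp add: tau_eq Q_def)
  show ?thesis
  \<comment> \<open>At \<open>S = 2 / 3\<close> both lower bounds for \<open>4 * tau G len\<close>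
    equal \<open>1 / 27\<close>: Cauchy-Schwarz does better below this threshold, the hypothesis on
    the multiplied graph above it.\<close>
  proof (cases "S \<le> 2 / 3")
    case True
    \<comment> \<open>Cauchy--Schwarz: \<open>S\<^sup>2 \<le> (\<Sum>e\<in>arcs G. len e) * P\<close>\<close>
    have "0 \<le> (\<Sum>e\<in>arcs G. (edge_resistance e - S * len e)\<^sup>2 / len e)"
      using len_pos by (intro sum_nonneg) (simp add: order_less_imp_le)
    also have "\<dots> = (\<Sum>e\<in>arcs G. (edge_resistance e)\<^sup>2 / len e - 2 * S * edge_resistance e + S\<^sup>2 * len e)"
    proof (intro sum.cong refl)
      fix e assume "e \<in> arcs G"
      then have "len e > 0" by (rule len_pos)
      then show "(edge_resistance e - S * len e)\<^sup>2 / len e =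
        (edge_resistance e)\<^sup>2 / len e - 2 * S * edge_resistance e + S\<^sup>2 * len e"
        by (simp add: power2_eq_square field_simps)
    qed
    also have "\<dots> = P - S\<^sup>2"
      by (simp add: sum.distrib sum_subtractf sum_distrib_left[symmetric] one S_def[symmetric]
          P_def[symmetric])
        (simp add: power2_eq_square)
    finally have "(1 - S)\<^sup>2 \<le> 1 - 2 * S + P" by (simp add: power2_eq_square algebra_simps)
    moreover have "1 / 9 \<le> (1 - S)\<^sup>2"
      using True power_mono[of "1 / 3" "1 - S" 2] by (simp add: power_divide)
    ultimately have "1 / 27 \<le> (1 - 2 * S + P) / 3" by simp
    then have "1 / 27 \<le> 4 * tau G len" unfolding tau using Q by linarith
    then show ?thesis by simp
  next
    case False
    have n: "real n \<ge> 2" using assms(3) by simp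
    have "4 * tau (DA_graph n G) (DA_length n len) =
        Q / (real n)\<^sup>2 + (1 - 2 * (1 / real n) * S + (1 / real n)\<^sup>2 * P) / 3"
      unfolding expand[symmetric] using assms(3) by (simp add: tau_DA_eq Q_def)
    then have "(real n)\<^sup>2 * (4 * tau (DA_graph n G) (DA_length n len)) =
        Q + ((real n)\<^sup>2 - 2 * real n * S + P) / 3"
      using n by (simp add: power2_eq_square field_simps)
    \<comment> \<open>After this scaling \<open>Q\<close> and \<open>P\<close> enter both constants
      with equal weights, so the difference depends on \<open>S\<close> and \<open>n\<close>
      only.\<close>
    also have "\<dots> = 4 * tau G len + ((real n)\<^sup>2 - 1 - 2 * (real n - 1) * S) / 3"
      unfolding tau by (simp add: field_simps)
    finally have eq: "(real n)\<^sup>2 * (4 * tau (DA_graph n G) (DA_length n len)) =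
        4 * tau G len + ((real n)\<^sup>2 - 1 - 2 * (real n - 1) * S) / 3" .
    have "(3 * real n - 2)\<^sup>2 / 27 = (real n)\<^sup>2 * (4 * (1 / 108 * ((3 * real n - 2) / real n)\<^sup>2))"
      using n by (simp add: power_divide)
    also have "\<dots> \<le> (real n)\<^sup>2 * (4 * tau (DA_graph n G) (DA_length n len))"
      using assms(4) by (intro mult_left_mono) auto
    finally have "(3 * real n - 2)\<^sup>2 / 27 \<le>
        4 * tau G len + ((real n)\<^sup>2 - 1 - 2 * (real n - 1) * S) / 3"
      unfolding eq .
    \<comment> \<open>With \<open>S\<close> lowered to \<open>2 / 3\<close> the dependence on
      \<open>n\<close> disappears: \<open>(3 * n - 2)\<^sup>2 / 27 - (n\<^sup>2 - 1) / 3 + 4 * (n -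
      1) / 9 = 1 / 27\<close>.\<close>
    moreover have "2 * (real n - 1) * (2 / 3) \<le> 2 * (real n - 1) * S"
      using False n by (intro mult_left_mono) auto
    ultimately show ?thesis by (simp add: power2_eq_square field_simps)
  qed
qed

end
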